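(* Let $X$ and $Y$ be Banach spaces, $C\in\mathcal{L}(X,Y)$, $P\in\mathcal{L}(X)$, $(S_t)_{t\ge0}$ a semigroup on $X$, $M\ge1$ and $\omega\in\mathbb{R}$ such that $\|S_t\|\le M\mathrm{e}^{\omega t}$ for all $t\ge0$, and assume that for all $x\in X$ the mapping $t\mapsto\|CS_tx\|_Y$ is measurable. Further, let $r\in[1,\infty]$, $T>0$, and let $C_1,C_2\colon(0,T]\to[0,\infty)$ be continuous functions such that for all $x\in X$ and $t\in(0,T]$ we have $$\|PS_tx\|_X\le C_1(t)\|CPS_tx\|_Y\quad\text{and}\quad\|(\mathrm{Id}-P)S_tx\|_X\le C_2(t)\|x\|_X.$$ Then there exist $C_{\mathrm{obs}}\ge0$ and $\alpha\ge0$ with $$\forall x\in X:\quad\|S_Tx\|_X\le\begin{cases}C_{\mathrm{obs}}\left(\int_0^T\|CS_tx\|_Y^r\,\mathrm{d}t\right)^{1/r}+\alpha\|x\|_X&\text{if }r\in[1,\infty),\\[1ex] C_{\mathrm{obs}}\sup_{t\in[0,T]}\|CS_tx\|_Y+\alpha\|x\|_X&\text{if }r=\infty,\end{cases}$$ satisfying for all $\delta\in[0,1)$ $$C_{\mathrm{obs}}\le\frac{M\mathrm{e}^{\omega_+T}}{(1-\delta)T^{1/r}}\max_{t\in[\delta T,T]}C_1(t)\quad\text{and}\quad \alpha\le\frac{M\mathrm{e}^{\omega_+T}}{(1-\delta)T}\int_{\delta T}^T\bigl(C_1(t)\|C\|_{\mathcal{L}(X,Y)}+1\bigr)C_2(t)\,\mathrm{d}t,$$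 where $\omega_+=\max\{\omega,0\}$ and $T^{1/r}=1$ if $r=\infty$.
   Context: A semigroup on a Banach space $X$ is a family $(S_t)_{t\ge0}$ in $\mathcal{L}(X)$ with $S_0=\mathrm{Id}$ and $S_{t+s}=S_tS_s$ for all $s,t\ge0$; no continuity in $t$ is assumed here. $\mathcal{L}(X,Y)$ denotes the bounded linear operators from $X$ to $Y$, $\mathcal{L}(X)=\mathcal{L}(X,X)$, and $\mathrm{Id}$ is the identity operator on $X$.
   Formalization: The constants C_obs and α may depend on δ: for each δ in [0,1) there is such a pair, since one pair for all δ fails in general. For δ=0 the maximum and the integral are taken over (0,T], the maximum as a supremum, and either may be infinite. *)

theory Defs
  imports "HOL-Analysis.Analysis"
begin

text \<open>
  A family indexed by all reals, of which only the members with index \<open>t \<ge> 0\<close> are constrained;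
  no continuity in \<open>t\<close> is required.
\<close>

definition op_semigroup :: "(real \<Rightarrow> 'a::real_normed_vector \<Rightarrow>\<^sub>L 'a) \<Rightarrow> bool" where
  "op_semigroup S \<longleftrightarrow>
     S 0 = id_blinfun \<and> (\<forall>t\<ge>0. \<forall>s\<ge>0. S (t + s) = S t o\<^sub>L S s)"

definition time_root :: "real \<Rightarrow> ennreal \<Rightarrow> real" where
  "time_root T r = (if r = \<infinity> then 1 else T powr (1 / enn2real r))"

text \<open>
  The \<open>L\<^sup>r(0,T)\<close>-size of a nonnegative \<open>f\<close>, with the plain (not essential) supremum over \<open>[0,T]\<close>
  for \<open>r = \<infinity>\<close>. Both branches are real valued and thus only meaningful for \<open>f\<close> bounded and
  measurable on \<open>[0,T]\<close>, as \<open>f t = \<parallel>C S\<^sub>t x\<parallel>\<close> is for an exponentially bounded semigroup.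
\<close>

definition obs_size :: "ennreal \<Rightarrow> real \<Rightarrow> (real \<Rightarrow> real) \<Rightarrow> real" where
  "obs_size r T f =
     (if r = \<infinity> then (SUP t\<in>{0..T}. f t)
      else (LINT t:{0..T}|lebesgue. f t powr enn2real r) powr (1 / enn2real r))"

text \<open>
  The upper bounds for the constants \<open>C\<^sub>o\<^sub>b\<^sub>s\<close> and \<open>\<alpha>\<close>. The functions \<open>C1\<close> and \<open>C2\<close> live on \<open>(0,T]\<close>,
  whence the intersection, which matters only for \<open>\<delta> = 0\<close>. In that case the maximum is a
  supremum over \<open>(0,T]\<close>, and both the supremum and the integral can be infinite;
  hence the values in \<^typ>\<open>ennreal\<close>. For \<open>\<delta> > 0\<close> both are finite and the supremum is a maximum.

  These bounds hold for constants that depend on \<open>\<delta>\<close>; a single pair of constants below all the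
  bounds at once does not exist in general. On \<open>X = \<real>\<^sup>2\<close> take \<open>S\<^sub>t = diag (1, exp (-5t))\<close>,
  \<open>P = diag (1, 0)\<close>, \<open>C x = x\<^sub>1 - x\<^sub>2\<close>, \<open>M = 1\<close>, \<open>\<omega> = 0\<close>, \<open>r = T = 1\<close>, \<open>C1 t = 1\<close>, \<open>C2 t = exp (-5t)\<close>:
  \<open>\<delta> = 0\<close> would force \<open>C\<^sub>o\<^sub>b\<^sub>s \<le> 1\<close> and \<open>\<delta> \<rightarrow> 1\<close> would force \<open>\<alpha> \<le> (sqrt 2 + 1) * exp (-5) < 0.017\<close>,
  but for \<open>x = (1,1)\<close> the final state has norm at least \<open>1\<close>, \<open>\<integral>\<bar>C S\<^sub>t x\<bar> dt < 0.81\<close> and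
  \<open>\<parallel>x\<parallel> = sqrt 2\<close>.
\<close>

definition cobs_bound ::
    "real \<Rightarrow> real \<Rightarrow> real \<Rightarrow> ennreal \<Rightarrow> (real \<Rightarrow> real) \<Rightarrow> real \<Rightarrow> ennreal" where
  "cobs_bound M \<omega> T r C1 \<delta> =
     ennreal (M * exp (max \<omega> 0 * T) / ((1 - \<delta>) * time_root T r)) *
     (SUP t\<in>{\<delta> * T..T} \<inter> {0<..T}. ennreal (C1 t))"

definition alpha_bound ::
    "real \<Rightarrow> real \<Rightarrow> real \<Rightarrow> real \<Rightarrow> (real \<Rightarrow> real) \<Rightarrow> (real \<Rightarrow> real) \<Rightarrow> real \<Rightarrow> ennreal" where
  "alpha_bound M \<omega> T normC C1 C2 \<delta> =
     ennreal (M * exp (max \<omega> 0 * T) / ((1 - \<delta>) * T)) *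
     (\<integral>\<^sup>+t\<in>{\<delta> * T..T} \<inter> {0<..T}. ennreal ((C1 t * normC + 1) * C2 t) \<partial>lborel)"

end

theory Submission
  imports Defs
begin

text \<open>
  Write \<open>f t = \<parallel>C S\<^sub>t x\<parallel>\<close>, \<open>g t = (C1 t * \<parallel>C\<parallel> + 1) * C2 t\<close> and \<open>K = M * exp (\<omega>\<^sub>+ * T)\<close>.
  The final state is controlled by every earlier one, \<open>\<parallel>S\<^sub>T x\<parallel> \<le> K * \<parallel>S\<^sub>t x\<parallel>\<close>, because
  \<open>S\<^sub>T = S\<^sub>T\<^sub>-\<^sub>t S\<^sub>t\<close>. Splitting \<open>S\<^sub>t x\<close> into its images under \<open>P\<close> and \<open>Id - P\<close>, the first is observed at
  cost \<open>C1 t\<close> and the second is small by dissipation; passing from \<open>C P S\<^sub>t x\<close> to \<open>C S\<^sub>t x\<close> costs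
  another \<open>\<parallel>C\<parallel>\<close> times the dissipated part. Hence, for every \<open>t \<in> (0,T]\<close>,
  \<open>\<parallel>S\<^sub>T x\<parallel> \<le> K * (C1 t * f t + g t * \<parallel>x\<parallel>)\<close>.
  Averaging over any set \<open>F \<subseteq> (0,T]\<close> of positive measure on which \<open>C1 \<le> m\<close>, and estimating the
  integral of \<open>f\<close> by its \<open>L\<^sup>r\<close>-size with Hoelder's inequality (\<open>set_integral_le_power_mean\<close>), gives the
  observability estimate with explicit constants (\<open>averaged_bound\<close>).

  The claimed bounds come from averaging over the time window \<open>E = [\<delta>T,T] \<inter> (0,T]\<close>. This is immediate
  when \<open>sup C1\<close> and \<open>\<integral> g\<close> over \<open>E\<close> are finite. For \<open>\<delta> = 0\<close> either of them can be infinite; then only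
  the other bound is a restriction, and different constants have to satisfy it.
  If \<open>\<integral> g\<close> is infinite, there is no restriction on \<open>\<alpha>\<close>, and the growth bound \<open>\<parallel>S\<^sub>T x\<parallel> \<le> K * \<parallel>x\<parallel>\<close> allows
  \<open>C\<^sub>o\<^sub>b\<^sub>s = 0\<close>. If only \<open>sup C1\<close> is infinite, any finite \<open>C\<^sub>o\<^sub>b\<^sub>s\<close> is permitted, but \<open>\<alpha>\<close> must not exceed \<open>K\<close>
  times the mean of \<open>g\<close> over \<open>E\<close>. Shrinking the window to a smaller interval \<open>[\<epsilon>,T]\<close> could increase
  this mean; instead one averages over a part of \<open>E\<close> on which \<open>g\<close> does not exceed its mean and \<open>C1\<close> is
  bounded (\<open>exists_subset_below_average\<close>).
\<close>

section \<open>Hoelder's inequality against the constant function\<close>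

text \<open>
  By Young's inequality for \<open>(y / c) * 1\<close>: the right-hand side is a tangent bound in \<open>y\<^sup>s\<close> with equality
  at \<open>y = c\<close>, so that the best choice of \<open>c\<close> can be postponed until after an integration.
\<close>

lemma affine_bound_by_power:
  fixes y c s :: real
  assumes "s \<ge> 1" "c > 0" "y \<ge> 0"
  shows "y \<le> c powr (1 - s) / s * y powr s + (1 - 1 / s) * c"
proof (cases "s = 1")
  case False
  with assms have s: "s > 1" by simp
  have "(y / c) * 1 \<le> (y / c) powr s / s + 1 powr (s / (s - 1)) / (s / (s - 1))"
    using s assms by (intro Youngs_inequality) (auto simp: field_simps)
  also have "\<dots> = y powr s / c powr s / s + (1 - 1 / s)"
    using s assms by (simp add: powr_divide field_simps)
  finally have "y / c * c \<le> (y powr s / c powr s / s + (1 - 1 / s)) * c"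
    using assms by (intro mult_right_mono) auto
  then show ?thesis
    using assms s by (simp add: powr_diff field_simps)
qed (use assms in auto)

text \<open>
  Integrating the affine bound leaves a one-parameter family of estimates, and the one at the
  \<open>s\<close>-mean \<open>c\<close> of \<open>f\<close> is the claim. If the \<open>s\<close>-mean vanishes, it is not an admissible \<open>c\<close>, and one lets
  \<open>c\<close> tend to \<open>0\<close> instead.
\<close>

lemma set_integral_le_power_mean:
  fixes f :: "'m \<Rightarrow> real"
  assumes E: "E \<in> sets M" "emeasure M E < \<infinity>" "measure M E > 0"
    and f: "set_integrable M E f" "\<And>t. t \<in> E \<Longrightarrow> f t \<ge> 0"
    and fs: "set_integrable M E (\<lambda>t. f t powr s)"
    and s: "s \<ge> 1"
  shows "(LINT t:E|M. f t) \<le>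
           measure M E * ((LINT t:E|M. f t powr s) / measure M E) powr (1 / s)"
proof -
  define m I where "m = measure M E" and "I = (LINT t:E|M. f t powr s)"
  have m: "m > 0" using E by (simp add: m_def)
  have I: "I \<ge> 0"
    unfolding I_def set_lebesgue_integral_def by (intro integral_nonneg_AE) auto
  have le: "(LINT t:E|M. f t) \<le> c powr (1 - s) / s * I + (1 - 1 / s) * c * m" if "c > 0" for c
  proof -
    have const: "set_integrable M E (\<lambda>_. (1 - 1 / s) * c)"
      using E by (auto simp: set_integrable_def)
    have "(LINT t:E|M. f t) \<le> (LINT t:E|M. c powr (1 - s) / s * f t powr s + (1 - 1 / s) * c)"
      using f fs that s by (intro set_integral_mono set_integral_add affine_bound_by_power const) auto
    also have "\<dots> = c powr (1 - s) / s * I + (1 - 1 / s) * c * m"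
      using E fs by (subst set_integral_add) (auto simp: const I_def m_def set_integral_const)
    finally show ?thesis .
  qed
  show ?thesis
  proof (cases "I = 0")
    case True
    have "(LINT t:E|M. f t) \<le> 0"
    proof (rule field_le_epsilon)
      fix e :: real assume e: "e > 0"
      have "(LINT t:E|M. f t) \<le> (1 - 1 / s) * (e / m) * m"
        using le[of "e / m"] e m True by simp
      also have "\<dots> \<le> e" using m e s by (simp add: field_simps)
      finally show "(LINT t:E|M. f t) \<le> 0 + e" by simp
    qed
    then show ?thesis using True by (simp add: I_def)
  next
    case False
    \<comment> \<open>A minimiser of the right-hand side of \<open>le\<close>.\<close>
    define c where "c = (I / m) powr (1 / s)"
    have c: "c > 0" "c powr s = I / m"
      using I m s False by (auto simp: c_def powr_powr)
    have "c powr (1 - s) / s * I + (1 - 1 / s) * c * m = m * c"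
      using c m s False by (simp add: powr_diff) (simp add: field_simps)
    then show ?thesis
      using le[OF c(1)] by (simp add: c_def m_def I_def)
  qed
qed

text \<open>
  Both meanings of \<^const>\<open>obs_size\<close> dominate the integral with the same factor \<open>T\<^sup>1\<^sup>-\<^sup>1\<^sup>/\<^sup>r\<close>, written as
  \<open>T / time_root T r\<close>, so that the case distinction on \<open>r\<close> is not met again. The bound on \<open>f\<close> makes
  the supremum and the integrals in \<^const>\<open>obs_size\<close> genuine.
\<close>

lemma set_integral_le_obs_size:
  fixes f :: "real \<Rightarrow> real"
  assumes T: "T > 0" and r: "r \<ge> 1"
    and meas: "set_borel_measurable lebesgue {0..T} f"
    and f: "\<And>t. t \<in> {0..T} \<Longrightarrow> 0 \<le> f t" "\<And>t. t \<in> {0..T} \<Longrightarrow> f t \<le> B"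
  shows "(LINT t:{0..T}|lebesgue. f t) \<le> T / time_root T r * obs_size r T f"
proof -
  have const: "set_integrable lebesgue {0..T} (\<lambda>_. c)" for c :: real
    using T by (auto simp: set_integrable_def)
  have int: "set_integrable lebesgue {0..T} f"
    using f by (intro set_integrable_bound[OF const[of B] meas]) (fastforce intro!: AE_I2)
  show ?thesis
  proof (cases "r = \<infinity>")
    case True
    have "(LINT t:{0..T}|lebesgue. f t) \<le> (LINT t:{0..T}|lebesgue. (SUP t\<in>{0..T}. f t))"
      using f by (intro set_integral_mono int const cSUP_upper bdd_aboveI2[of _ _ B])
    also have "\<dots> = T * (SUP t\<in>{0..T}. f t)" using T by (simp add: set_integral_const)
    finally show ?thesis by (simp add: True time_root_def obs_size_def)
  next
    case False
    define s where "s = enn2real r"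
    have s: "s \<ge> 1"
      unfolding s_def using r False
      by (metis enn2real_mono enn2real_1 infinity_ennreal_def top.not_eq_extremum)
    have "set_borel_measurable lebesgue {0..T} (\<lambda>t. f t powr s)"
    proof -
      have "(\<lambda>t. (indicator {0..T} t *\<^sub>R f t) powr s) \<in> borel_measurable lebesgue"
        using meas unfolding set_borel_measurable_def by measurable
      moreover have "(\<lambda>t. (indicator {0..T} t *\<^sub>R f t) powr s)
          = (\<lambda>t. indicator {0..T} t *\<^sub>R f t powr s)"
        by (auto simp: indicator_def)
      ultimately show ?thesis by (simp add: set_borel_measurable_def)
    qed
    then have ints: "set_integrable lebesgue {0..T} (\<lambda>t. f t powr s)"
      using f s by (intro set_integrable_bound[OF const[of "B powr s"]] AE_I2)
        (auto intro!: powr_mono2)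
    define I where "I = (LINT t:{0..T}|lebesgue. f t powr s)"
    have I: "I \<ge> 0"
      unfolding I_def set_lebesgue_integral_def by (intro integral_nonneg_AE) auto
    have "(LINT t:{0..T}|lebesgue. f t) \<le> T * (I / T) powr (1 / s)"
      using set_integral_le_power_mean[OF _ _ _ int f(1) ints s] T by (simp add: I_def)
    also have "\<dots> = T / time_root T r * obs_size r T f"
      using False I T by (simp add: time_root_def obs_size_def I_def s_def powr_divide)
    finally show ?thesis .
  qed
qed

section \<open>Averaging a pointwise estimate over a set of times\<close>

text \<open>
  An integrable function cannot exceed its mean almost everywhere, so the sublevel set of \<open>g\<close> at its
  mean has positive measure. It is the increasing union of its parts with \<open>c \<le> n\<close>, one of which
  therefore has positive measure too.
\<close>

lemma exists_subset_below_average: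
  fixes g c :: "'m \<Rightarrow> real"
  assumes E: "E \<in> sets M" "emeasure M E < \<infinity>" "measure M E > 0"
    and g: "set_integrable M E g" and c: "set_borel_measurable M E c"
  obtains F n where "F \<in> sets M" "F \<subseteq> E" "measure M F > 0"
    "\<And>t. t \<in> F \<Longrightarrow> c t \<le> real n" "\<And>t. t \<in> F \<Longrightarrow> g t \<le> (LINT t:E|M. g t) / measure M E"
proof -
  define a where "a = (LINT t:E|M. g t) / measure M E"
  define F where "F n = {t\<in>space M. t \<in> E \<and> indicator E t *\<^sub>R g t \<le> a
    \<and> indicator E t *\<^sub>R c t \<le> real n}" for n :: nat
  have [measurable]: "E \<in> sets M" "(\<lambda>t. indicator E t *\<^sub>R g t) \<in> borel_measurable M"
    "(\<lambda>t. indicator E t *\<^sub>R c t) \<in> borel_measurable M"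
    using E g c by (auto simp: set_integrable_def set_borel_measurable_def)
  have F: "F n \<in> sets M" for n unfolding F_def by measurable
  have sub: "F n \<subseteq> E" for n by (auto simp: F_def)
  have un: "t \<in> (\<Union>n. F n)" if "t \<in> E" "g t \<le> a" for t
    using that real_arch_simple[of "c t"] sets.sets_into_space[OF E(1)] by (auto simp: F_def)
  have "\<exists>n. emeasure M (F n) \<noteq> 0"
  proof (rule ccontr)
    assume "\<not> ?thesis"
    then have null: "emeasure M (\<Union>n. F n) = 0"
      using F by (intro emeasure_UN_eq_0) auto
    have gt: "AE t in M. t \<in> E \<longrightarrow> g t > a"
      using un F null by (intro AE_I[where N = "\<Union>n. F n"]) force+
    have const: "set_integrable M E (\<lambda>_. a)" using E by (auto simp: set_integrable_def)
    have diff: "set_integrable M E (\<lambda>t. g t - a)" using g const by auto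
    have "(LINT t:E|M. g t - a) = 0"
      using E g const by (simp add: set_integral_diff set_integral_const a_def)
    moreover have "AE t in M. 0 \<le> indicator E t *\<^sub>R (g t - a)"
      using gt by eventually_elim (auto simp: indicator_def)
    ultimately have "AE t in M. indicator E t *\<^sub>R (g t - a) = 0"
      using diff unfolding set_integrable_def set_lebesgue_integral_def
      by (subst (asm) integral_nonneg_eq_0_iff_AE) auto
    with gt have "AE t in M. t \<notin> E"
      by eventually_elim (auto simp: indicator_def)
    then have "E \<in> null_sets M"
      using E(1) by (simp add: AE_iff_null_sets)
    then have "measure M E = 0"
      by (simp add: null_setsD1 measure_def)
    with E show False by simp
  qed
  then obtain n where n: "emeasure M (F n) \<noteq> 0" by blast
  have "emeasure M (F n) \<le> emeasure M E" using sub E by (intro emeasure_mono) auto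
  with n E have "measure M (F n) > 0"
    by (simp add: measure_def enn2real_positive_iff zero_less_iff_neq_zero)
  then show ?thesis
    using F sub by (intro that[of "F n" n]) (auto simp: F_def a_def)
qed

text \<open>
  The integral of \<open>f\<close> over \<open>F\<close> is enlarged to the whole of \<open>[0,T]\<close> before Hoelder's inequality is
  applied. This is why the bound on \<open>C\<^sub>o\<^sub>b\<^sub>s\<close> carries the root of \<open>T\<close> rather than a root of the measure
  of \<open>F\<close>.
\<close>

lemma averaged_bound:
  fixes c f g :: "real \<Rightarrow> real"
  assumes F: "F \<in> sets lebesgue" "F \<subseteq> {0..T}" "measure lebesgue F > 0"
    and T: "T > 0" and r: "r \<ge> 1" and K: "K \<ge> 0" and m: "m \<ge> 0"
    and meas: "set_borel_measurable lebesgue {0..T} f"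
    and f: "\<And>t. t \<in> {0..T} \<Longrightarrow> 0 \<le> f t" "\<And>t. t \<in> {0..T} \<Longrightarrow> f t \<le> B"
    and g: "set_integrable lebesgue F g" and c: "\<And>t. t \<in> F \<Longrightarrow> c t \<le> m"
    and N: "\<And>t. t \<in> F \<Longrightarrow> N \<le> K * (c t * f t + g t * y)"
  shows "N \<le> K * m * T / (measure lebesgue F * time_root T r) * obs_size r T f
           + K / measure lebesgue F * (LINT t:F|lebesgue. g t) * y"
proof -
  let ?\<mu> = "measure lebesgue F"
  have fin: "emeasure lebesgue F < \<infinity>"
    using emeasure_mono[OF F(2), of lebesgue] T by (simp add: order_le_less_trans)
  have const: "set_integrable lebesgue {0..T} (\<lambda>_. b)" for b :: real
    using T by (auto simp: set_integrable_def)
  have f_int: "set_integrable lebesgue {0..T} f"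
    using f by (intro set_integrable_bound[OF const[of B] meas]) fastforce
  have f_intF: "set_integrable lebesgue F f"
    using F by (intro set_integrable_subset[OF f_int])
  have constF: "set_integrable lebesgue F (\<lambda>_. N)"
    using F fin by (auto simp: set_integrable_def)
  have Fint: "set_integrable lebesgue F (\<lambda>t. K * (m * f t + g t * y))"
    using f_intF g by (intro set_integrable_mult_right set_integral_add set_integrable_mult_left)
  have "?\<mu> * N = (LINT t:F|lebesgue. N)"
    using F fin by (simp add: set_integral_const)
  also have "\<dots> \<le> (LINT t:F|lebesgue. K * (m * f t + g t * y))"
  proof (intro set_integral_mono constF Fint)
    fix t assume t: "t \<in> F"
    then have "c t * f t \<le> m * f t" using F f c by (intro mult_right_mono) auto
    then show "N \<le> K * (m * f t + g t * y)"
      using N[OF t] K by (smt (verit) mult_left_mono)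
  qed
  also have "\<dots> = K * (m * (LINT t:F|lebesgue. f t) + (LINT t:F|lebesgue. g t) * y)"
    using f_intF g by (simp add: set_integral_add)
  also have "(LINT t:F|lebesgue. f t) \<le> (LINT t:{0..T}|lebesgue. f t)"
    using f_intF f_int F f unfolding set_integrable_def set_lebesgue_integral_def
    by (intro integral_mono) (auto simp: indicator_def)
  also have "(LINT t:{0..T}|lebesgue. f t) \<le> T / time_root T r * obs_size r T f"
    using assms by (intro set_integral_le_obs_size[where B = B]) auto
  finally have "?\<mu> * N \<le> K * (m * (T / time_root T r * obs_size r T f)
      + (LINT t:F|lebesgue. g t) * y)"
    using K m by (simp add: mult_left_mono)
  then have "N \<le> K * (m * (T / time_root T r * obs_size r T f)
      + (LINT t:F|lebesgue. g t) * y) / ?\<mu>"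
    using F by (simp add: field_simps)
  also have "\<dots> = K * m * T / (?\<mu> * time_root T r) * obs_size r T f
           + K / ?\<mu> * (LINT t:F|lebesgue. g t) * y"
    by (simp add: add_divide_distrib distrib_left mult_ac)
  finally show ?thesis .
qed

section \<open>Pointwise estimates for the semigroup\<close>

text \<open>
  Since \<open>C P z = C z - C (Id - P) z\<close>, observing \<open>z\<close> instead of \<open>P z\<close> costs at most \<open>\<parallel>C\<parallel> * b\<close>.
\<close>

lemma dissipation_estimate:
  fixes C :: "'a::real_normed_vector \<Rightarrow>\<^sub>L 'b::real_normed_vector"
    and P :: "'a \<Rightarrow>\<^sub>L 'a" and z :: 'a
  assumes "norm (P z) \<le> a * norm (C (P z))" and "norm ((id_blinfun - P) z) \<le> b" and "a \<ge> 0"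
  shows "norm z \<le> a * norm (C z) + (a * norm C + 1) * b"
proof -
  let ?q = "(id_blinfun - P) z"
  have z: "P z = z - ?q" by (simp add: blinfun.diff_left)
  have "norm (C ?q) \<le> norm C * b"
    using norm_blinfun[of C ?q] assms(2) by (meson mult_left_mono norm_ge_zero order_trans)
  then have "norm (C (P z)) \<le> norm (C z) + norm C * b"
    unfolding z blinfun.diff_right using norm_triangle_ineq4[of "C z" "C ?q"] by linarith
  then have "norm (P z) \<le> a * (norm (C z) + norm C * b)"
    using assms(1,3) by (meson mult_left_mono order_trans)
  moreover have "norm z \<le> norm (P z) + norm ?q"
    using norm_triangle_ineq[of "P z" ?q] by (simp add: z)
  ultimately show ?thesis
    using assms(2) by (simp add: algebra_simps)
qed

lemma norm_semigroup_le:
  assumes "op_semigroup S" "M \<ge> 1" and S: "\<And>t. t \<ge> 0 \<Longrightarrow> norm (S t) \<le> M * exp (\<omega> * t)"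
    and t: "0 \<le> t" "t \<le> T"
  shows "norm (S t x) \<le> M * exp (max \<omega> 0 * T) * norm x"
    and "norm (S T x) \<le> M * exp (max \<omega> 0 * T) * norm (S t x)"
proof -
  have le: "norm (S s y) \<le> M * exp (max \<omega> 0 * T) * norm y" if "0 \<le> s" "s \<le> T" for s y
  proof -
    have "\<omega> * s \<le> max \<omega> 0 * s" using that by (intro mult_right_mono) auto
    also have "\<dots> \<le> max \<omega> 0 * T" using that by (intro mult_left_mono) auto
    finally have "norm (S s) \<le> M * exp (max \<omega> 0 * T)"
      using S[OF that(1)] assms(2) by (smt (verit) exp_le_cancel_iff mult_left_mono)
    then show ?thesis
      using norm_blinfun[of "S s" y] by (meson mult_right_mono norm_ge_zero order_trans)
  qed
  show "norm (S t x) \<le> M * exp (max \<omega> 0 * T) * norm x" using t by (rule le)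
  have "S ((T - t) + t) = S (T - t) o\<^sub>L S t"
    using assms(1) t unfolding op_semigroup_def by (metis diff_ge_0_iff_ge)
  then show "norm (S T x) \<le> M * exp (max \<omega> 0 * T) * norm (S t x)"
    using le[of "T - t" "S t x"] t by simp
qed

section \<open>The constants below the prescribed bounds\<close>

lemma measure_time_window:
  fixes T \<delta> :: real
  assumes "0 \<le> \<delta>" "\<delta> < 1" "T > 0"
  shows "measure lebesgue ({\<delta> * T..T} \<inter> {0<..T}) = (1 - \<delta>) * T"
proof -
  have "\<delta> * T \<le> T" using assms by simp
  moreover have "{\<delta> * T..T} \<inter> {0<..T} = (if \<delta> = 0 then {0<..T} else {\<delta> * T..T})"
  proof (cases "\<delta> = 0")
    case False
    then have "0 < \<delta> * T" using assms by simp
    then show ?thesis using False by auto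
  qed auto
  ultimately show ?thesis using assms by (simp add: algebra_simps)
qed

text \<open>
  The choice of constants, separated from the semigroup: \<open>N x\<close> stands for the norm of the final
  state, \<open>f x\<close> for the observation along the orbit of \<open>x\<close>, and \<open>E\<close> for a time window of measure \<open>L\<close>.
  The proof distinguishes whether the integral of \<open>g\<close> and the supremum of \<open>C1\<close> over \<open>E\<close> are infinite.
\<close>

lemma observability_below_bounds:
  fixes C1 g :: "real \<Rightarrow> real" and f :: "'x::real_normed_vector \<Rightarrow> real \<Rightarrow> real"
    and N :: "'x \<Rightarrow> real"
  assumes T: "T > 0" and r: "r \<ge> 1" and K: "K > 0" and L: "0 < L"
    and E: "E \<in> sets borel" "E \<subseteq> {0..T}" "measure lebesgue E = L"
    and C1: "set_borel_measurable borel E C1"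
    and g: "set_borel_measurable borel E g" "\<And>t. t \<in> E \<Longrightarrow> 0 \<le> g t"
    and meas: "\<And>x. set_borel_measurable lebesgue {0..T} (f x)"
    and f: "\<And>x t. t \<in> {0..T} \<Longrightarrow> 0 \<le> f x t" "\<And>x t. t \<in> {0..T} \<Longrightarrow> f x t \<le> B * norm x"
    and trivial: "\<And>x. N x \<le> K * norm x"
    and N: "\<And>x t. t \<in> E \<Longrightarrow> N x \<le> K * (C1 t * f x t + g t * norm x)"
  shows "\<exists>Cobs\<ge>0. \<exists>\<alpha>\<ge>0. (\<forall>x. N x \<le> Cobs * obs_size r T (f x) + \<alpha> * norm x) \<and>
           ennreal Cobs \<le> ennreal (K * T / (L * time_root T r)) * (SUP t\<in>E. ennreal (C1 t)) \<and>
           ennreal \<alpha> \<le> ennreal (K / L) * (\<integral>\<^sup>+t\<in>E. ennreal (g t) \<partial>lborel)"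
proof -
  let ?A = "\<integral>\<^sup>+t\<in>E. ennreal (g t) \<partial>lborel" and ?Q = "SUP t\<in>E. ennreal (C1 t)"
  have KL: "K / L > 0" using K L by simp
  have root: "time_root T r > 0" using T by (simp add: time_root_def)
  have EL: "E \<in> sets lebesgue" using E(1) by simp
  have Efin: "emeasure lebesgue E < \<infinity>"
    using emeasure_mono[OF E(2), of lebesgue] T by (simp add: order_le_less_trans)
  have witness: ?thesis if "0 \<le> c" "0 \<le> a" "\<And>x. N x \<le> c * obs_size r T (f x) + a * norm x"
    "ennreal c \<le> ennreal (K * T / (L * time_root T r)) * ?Q" "ennreal a \<le> ennreal (K / L) * ?A"
    for c a using that by blast
  show ?thesis
  proof (cases "?A = \<infinity>")
    case True
    then have "ennreal (K / L) * ?A = \<infinity>"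
      using K L by (simp add: ennreal_mult_eq_top_iff)
    \<comment> \<open>\<open>\<alpha>\<close> is unrestricted, so the estimate without any observation is good enough.\<close>
    then show ?thesis
      using trivial K by (intro witness[of 0 K]) auto
  next
    case False
    have g_lebesgue: "(\<lambda>t. indicator E t *\<^sub>R g t) \<in> borel_measurable lborel"
      using g(1) by (simp add: set_borel_measurable_def)
    have A_eq: "?A = (\<integral>\<^sup>+t. ennreal (indicator E t *\<^sub>R g t) \<partial>lborel)"
      by (intro nn_integral_cong) (simp add: indicator_def)
    have nonneg: "0 \<le> indicator E t *\<^sub>R g t" for t using g(2) by (simp add: indicator_def)
    have "integrable lborel (\<lambda>t. indicator E t *\<^sub>R g t)"
      using False A_eq nonneg g_lebesgue by (intro integrableI_nonneg) (auto simp: less_top)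
    then have g_int: "set_integrable lebesgue E g"
      and A: "?A = ennreal (LINT t:E|lebesgue. g t)"
      using nonneg g_lebesgue A_eq
      by (simp_all add: set_integrable_def set_lebesgue_integral_def integrable_completion
          integral_completion nn_integral_eq_integral)
    have gi_nonneg: "0 \<le> (LINT t:F|lebesgue. g t)" if "F \<subseteq> E" for F
      unfolding set_lebesgue_integral_def using g(2) that
      by (intro integral_nonneg_AE) (auto simp: indicator_def)
    have KLA: "ennreal (K / L) * ?A = ennreal (K / L * (LINT t:E|lebesgue. g t))"
      unfolding A using KL by (intro ennreal_mult'[symmetric]) simp
    have bound: "N x \<le> K * m * T / (measure lebesgue F * time_root T r) * obs_size r T (f x)
           + K / measure lebesgue F * (LINT t:F|lebesgue. g t) * norm x"
      if "F \<in> sets lebesgue" "F \<subseteq> E" "measure lebesgue F > 0" "m \<ge> 0"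
        "\<And>t. t \<in> F \<Longrightarrow> C1 t \<le> m" for F m x
      using that E K N
      by (intro averaged_bound[where c = C1 and B = "B * norm x"] T r meas f
          set_integrable_subset[OF g_int]) auto
    show ?thesis
    proof (cases "?Q = \<infinity>")
      case False
      define m where "m = enn2real ?Q"
      have m: "m \<ge> 0" by (simp add: m_def)
      have Q: "?Q = ennreal m"
        using False by (simp only: m_def ennreal_enn2real_if infinity_ennreal_def if_False)
      have le: "C1 t \<le> m" if "t \<in> E" for t
        using SUP_upper[OF that, of "\<lambda>t. ennreal (C1 t)"] m by (simp only: Q ennreal_le_iff)
      have main: "N x \<le> K * m * T / (L * time_root T r) * obs_size r T (f x)
          + K / L * (LINT t:E|lebesgue. g t) * norm x" for x
        using bound[of E m x] EL L E(3) le m by simp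
      show ?thesis
      proof (rule witness[OF _ _ main])
        show "0 \<le> K * m * T / (L * time_root T r)" using K L T root m by simp
        show "0 \<le> K / L * (LINT t:E|lebesgue. g t)" using K L gi_nonneg[of E] by simp
        show "ennreal (K * m * T / (L * time_root T r))
            \<le> ennreal (K * T / (L * time_root T r)) * ?Q"
          using K L T root m unfolding Q by (simp add: mult_ac flip: ennreal_mult)
        show "ennreal (K / L * (LINT t:E|lebesgue. g t)) \<le> ennreal (K / L) * ?A"
          by (simp only: KLA order_refl)
      qed
    next
      case True
      \<comment> \<open>\<open>C\<^sub>o\<^sub>b\<^sub>s\<close> is unrestricted, but averaging must not be done over all of \<open>E\<close>, where \<open>C1\<close> is unbounded.\<close>
      have "set_borel_measurable lebesgue E C1"
        using C1(1) by (simp add: set_borel_measurable_def measurable_completion)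
      then obtain F n where F: "F \<in> sets lebesgue" "F \<subseteq> E" "measure lebesgue F > 0"
        and Fn: "\<And>t. t \<in> F \<Longrightarrow> C1 t \<le> real n"
        and Fg: "\<And>t. t \<in> F \<Longrightarrow> g t \<le> (LINT t:E|lebesgue. g t) / L"
        using exists_subset_below_average[OF EL Efin _ g_int] L E(3) by metis
      have Ffin: "emeasure lebesgue F < \<infinity>"
        using emeasure_mono[OF F(2), of lebesgue] Efin EL by (simp add: order_le_less_trans)
      have "(LINT t:F|lebesgue. g t) \<le> (LINT t:F|lebesgue. (LINT t:E|lebesgue. g t) / L)"
        using Fg F Ffin g_int
        by (intro set_integral_mono set_integrable_subset[OF g_int]) (auto simp: set_integrable_def)
      also have "\<dots> = measure lebesgue F * ((LINT t:E|lebesgue. g t) / L)"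
        using F Ffin by (simp add: set_integral_const)
      finally have avg: "(LINT t:F|lebesgue. g t) / measure lebesgue F
          \<le> (LINT t:E|lebesgue. g t) / L"
        using F(3) by (simp add: field_simps)
      define \<alpha> where "\<alpha> = K / measure lebesgue F * (LINT t:F|lebesgue. g t)"
      have \<alpha>: "0 \<le> \<alpha>" "\<alpha> \<le> K / L * (LINT t:E|lebesgue. g t)"
        using mult_left_mono[OF avg, of K] K F(3) gi_nonneg[OF F(2)] by (auto simp: \<alpha>_def)
      have "ennreal \<alpha> \<le> ennreal (K / L) * ?A"
        using \<alpha>(2) unfolding KLA by (rule ennreal_leI)
      moreover have "ennreal (K * T / (L * time_root T r)) * ?Q = \<infinity>"
        using True K L T root by (simp add: ennreal_mult_eq_top_iff)
      moreover have "N x \<le> K * real n * T / (measure lebesgue F * time_root T r)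
          * obs_size r T (f x) + \<alpha> * norm x" for x
        using bound[OF F, of "real n" x] Fn by (simp add: \<alpha>_def)
      ultimately show ?thesis
        using \<alpha>(1) K T root F(3)
        by (intro witness[of "K * real n * T / (measure lebesgue F * time_root T r)" \<alpha>]) simp_all
    qed
  qed
qed

theorem proposition3p1:
  fixes C :: "'a::banach \<Rightarrow>\<^sub>L 'b::banach"
    and P :: "'a \<Rightarrow>\<^sub>L 'a"
    and S :: "real \<Rightarrow> 'a \<Rightarrow>\<^sub>L 'a"
    and M \<omega> T :: real
    and r :: ennreal
    and C1 C2 :: "real \<Rightarrow> real"
  assumes "op_semigroup S"
    and "M \<ge> 1"
    and "\<And>t. t \<ge> 0 \<Longrightarrow> norm (S t) \<le> M * exp (\<omega> * t)"
    and "\<And>x. (\<lambda>t. norm (C (S t x))) \<in> borel_measurable (lebesgue_on {0..})"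
    and "r \<ge> 1"
    and "T > 0"
    and "continuous_on {0<..T} C1" and "\<And>t. t \<in> {0<..T} \<Longrightarrow> C1 t \<ge> 0"
    and "continuous_on {0<..T} C2" and "\<And>t. t \<in> {0<..T} \<Longrightarrow> C2 t \<ge> 0"
    and "\<And>x t. t \<in> {0<..T} \<Longrightarrow> norm (P (S t x)) \<le> C1 t * norm (C (P (S t x)))"
    and "\<And>x t. t \<in> {0<..T} \<Longrightarrow> norm ((id_blinfun - P) (S t x)) \<le> C2 t * norm x"
  shows "\<forall>\<delta>\<in>{0..<1}. \<exists>Cobs\<ge>0. \<exists>\<alpha>\<ge>0.
           (\<forall>x. norm (S T x) \<le> Cobs * obs_size r T (\<lambda>t. norm (C (S t x))) + \<alpha> * norm x) \<and>
           ennreal Cobs \<le> cobs_bound M \<omega> T r C1 \<delta> \<and>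
           ennreal \<alpha> \<le> alpha_bound M \<omega> T (norm C) C1 C2 \<delta>"
proof
  fix \<delta> :: real assume "\<delta> \<in> {0..<1}"
  then have \<delta>: "0 \<le> \<delta>" "\<delta> < 1" by auto
  define K where "K = M * exp (max \<omega> 0 * T)"
  define g where "g t = (C1 t * norm C + 1) * C2 t" for t
  define E where "E = {\<delta> * T..T} \<inter> {0<..T}"
  have K: "K > 0" using assms(2) by (simp add: K_def)
  have E: "E \<in> sets borel" "E \<subseteq> {0<..T}" by (auto simp: E_def)
  have measE: "measure lebesgue E = (1 - \<delta>) * T"
    using measure_time_window[OF \<delta> assms(6)] by (simp add: E_def)
  have C1: "continuous_on E C1" using assms(7) E(2) by (rule continuous_on_subset)
  have C2: "continuous_on E C2" using assms(9) E(2) by (rule continuous_on_subset)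
  note S = norm_semigroup_le[OF assms(1-3), where T = T, folded K_def]
  have meas: "set_borel_measurable lebesgue {0..T} (\<lambda>t. norm (C (S t x)))" for x
  proof -
    have "set_borel_measurable lebesgue {0..} (\<lambda>t. norm (C (S t x)))"
      using assms(4)[of x] by (simp add: borel_measurable_restrict_space_iff set_borel_measurable_def)
    then show ?thesis by (rule set_borel_measurable_subset) auto
  qed
  have bdd: "norm (C (S t x)) \<le> (norm C * K) * norm x" if "t \<in> {0..T}" for t x
    using norm_blinfun[of C "S t x"] mult_left_mono[OF S(1)[of t x], of "norm C"] that
    by (simp add: mult.assoc)
  have pointwise: "norm (S T x) \<le> K * (C1 t * norm (C (S t x)) + g t * norm x)"
    if "t \<in> E" for x t
  proof -
    have t: "t \<in> {0<..T}" using that E(2) by auto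
    have "norm (S T x) \<le> K * norm (S t x)" using t by (intro S(2)) auto
    also have "norm (S t x) \<le> C1 t * norm (C (S t x)) + (C1 t * norm C + 1) * (C2 t * norm x)"
      using t assms(8,11,12) by (intro dissipation_estimate) auto
    finally show ?thesis using K by (simp add: g_def mult.assoc mult_left_mono)
  qed
  have "\<exists>Cobs\<ge>0. \<exists>\<alpha>\<ge>0.
      (\<forall>x. norm (S T x) \<le> Cobs * obs_size r T (\<lambda>t. norm (C (S t x))) + \<alpha> * norm x) \<and>
      ennreal Cobs \<le> ennreal (K * T / ((1 - \<delta>) * T * time_root T r)) * (SUP t\<in>E. ennreal (C1 t)) \<and>
      ennreal \<alpha> \<le> ennreal (K / ((1 - \<delta>) * T)) * (\<integral>\<^sup>+t\<in>E. ennreal (g t) \<partial>lborel)"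
  proof (rule observability_below_bounds[OF assms(6) assms(5) K _ E(1) _ measE,
        where B = "norm C * K"])
    show "set_borel_measurable borel E C1" "set_borel_measurable borel E g"
      using C1 C2 E(1) unfolding g_def set_borel_measurable_def
      by (auto intro!: borel_measurable_continuous_on_indicator continuous_intros
          simp del: real_scaleR_def)
    show "norm (S T x) \<le> K * norm x" for x using S(1)[of T x] assms(6) by simp
  qed (use \<delta> assms(6,8,10) E(2) meas bdd pointwise in \<open>auto simp: g_def\<close>)
  moreover have "K * T / ((1 - \<delta>) * T * time_root T r) = K / ((1 - \<delta>) * time_root T r)"
    using assms(6) by simp
  ultimately show "\<exists>Cobs\<ge>0. \<exists>\<alpha>\<ge>0.
      (\<forall>x. norm (S T x) \<le> Cobs * obs_size r T (\<lambda>t. norm (C (S t x))) + \<alpha> * norm x) \<and>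
      ennreal Cobs \<le> cobs_bound M \<omega> T r C1 \<delta> \<and>
      ennreal \<alpha> \<le> alpha_bound M \<omega> T (norm C) C1 C2 \<delta>"
    unfolding cobs_bound_def alpha_bound_def K_def[symmetric] E_def[symmetric]
      g_def[symmetric] by simp
qed

end
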